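(* Let $\Omega_I := (0,1)\times(-1,1)$ and let $\mathcal{M}\subset L_2(\Omega_I)$ be the set of all distributional solutions $u_\mu$, $\mu\in\mathcal{D}:=[0,1]$, of the initial-boundary-value problem for the wave equation $$\partial_{tt}u_\mu(t,x)-\mu^2\,\partial_{xx}u_\mu(t,x)=0,\quad (t,x)\in\Omega_I,$$ $$u_\mu(0,x)=u_0(x):=\begin{cases}1,& x<0,\\ -1,& x\ge 0,\end{cases}\qquad \partial_t u_\mu(0,x)=0,\quad x\in(-1,1),$$ $$u_\mu(t,-1)=1,\qquad u_\mu(t,1)=-1,\quad t\in(0,1).$$ Then for every integer $N\ge 1$ the Kolmogorov $N$-width of $\mathcal{M}$ in $H=L_2(\Omega_I)$ satisfies $$d_N(\mathcal{M})\ \ge\ \frac14\,N^{-1/2}.$$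
   Context: Functions are real-valued and variables are ordered as $(t,x)$ (time $t$, space $x$). Kolmogorov $N$-width: for a subset $S$ of a normed space $H$ with norm $\|\cdot\|_H$, $$d_N(S):=\inf_{V_N\subset H,\ \dim V_N=N}\ \sup_{u\in S}\ \inf_{v\in V_N}\|u-v\|_H,$$ where the first infimum is over linear subspaces $V_N$ of $H$ of dimension $N$. Here $H=L_2(\Omega_I)$ with its usual norm. Distributional solution: $u\in L_2(\Omega_I)$ is a distributional solution of the initial-boundary-value problem with parameter $\mu$ if for every $\phi\in C_c^\infty((-\infty,1)\times\mathbb{R})$ with $\phi(t,-1)=\phi(t,1)=0$ for all $t\in[0,1)$, $$\int_0^1\!\!\int_{-1}^1 u\,(\partial_{tt}\phi-\mu^2\partial_{xx}\phi)\,dx\,dt+\int_{-1}^1u_0(x)\,\partial_t\phi(0,x)\,dx-\mu^2\int_0^1\big(\partial_x\phi(t,1)+\partial_x\phi(t,-1)\big)\,dt=0.$$ This is the equation tested against $\phi$ and integrated by parts twice in each variable, with the initial and boundary data inserted. *)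

theory Defs
  imports "HOL-Analysis.Analysis"
begin

text \<open>Finite-dimensionality is required explicitly because \<^const>\<open>dim\<close> is 0 on
  infinite-dimensional subspaces.  The values are taken in the complete lattice of extended
  nonnegative reals, so that suprema over unbounded sets are infinite rather than unspecified.\<close>

definition kolmogorov_width :: "nat \<Rightarrow> 'a::real_normed_vector set \<Rightarrow> ennreal" where
  "kolmogorov_width N S =
     (INF V\<in>{V. subspace V \<and> (\<exists>B. finite B \<and> span B = V) \<and> dim V = N}.
        SUP u\<in>S. INF v\<in>V. ennreal (norm (u - v)))"

definition Omega :: "(real \<times> real) set" where
  "Omega = {0<..<1} \<times> {-1<..<1}"

definition omega_measure :: "(real \<times> real) measure" where
  "omega_measure = restrict_space lborel Omega"

text \<open>Representatives are Borel measurable on \<open>Omega\<close>.  Every Lebesgue measurable function agrees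
  almost everywhere with a Borel measurable one, so this gives the usual space of classes.
  Values outside \<open>Omega\<close> are irrelevant.\<close>

definition square_integrable :: "(real \<times> real \<Rightarrow> real) \<Rightarrow> bool" where
  "square_integrable u \<longleftrightarrow>
     u \<in> borel_measurable omega_measure \<and> integrable omega_measure (\<lambda>p. (u p)\<^sup>2)"

definition L2_rel :: "(real \<times> real \<Rightarrow> real) \<Rightarrow> (real \<times> real \<Rightarrow> real) \<Rightarrow> bool" where
  "L2_rel u v \<longleftrightarrow> square_integrable u \<and> square_integrable v \<and> (AE p in omega_measure. u p = v p)"

lemma square_integrable_zero: "square_integrable (\<lambda>p. 0)"
  by (simp add: square_integrable_def)

lemma square_integrable_mult:
  assumes "square_integrable u" "square_integrable v"
  shows "integrable omega_measure (\<lambda>p. u p * v p)"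
proof (rule Bochner_Integration.integrable_bound)
  show "integrable omega_measure (\<lambda>p. (u p)\<^sup>2 + (v p)\<^sup>2)"
    using assms by (simp add: square_integrable_def)
  show "(\<lambda>p. u p * v p) \<in> borel_measurable omega_measure"
    using assms by (auto simp: square_integrable_def)
  have "\<bar>a * b\<bar> \<le> a\<^sup>2 + b\<^sup>2" for a b :: real
  proof -
    have "2 * (\<bar>a\<bar> * \<bar>b\<bar>) \<le> a\<^sup>2 + b\<^sup>2"
      using sum_squares_bound[of "\<bar>a\<bar>" "\<bar>b\<bar>"] by simp
    moreover have "0 \<le> \<bar>a\<bar> * \<bar>b\<bar>" by simp
    ultimately show ?thesis unfolding abs_mult by linarith
  qed
  then show "AE p in omega_measure. norm (u p * v p) \<le> norm ((u p)\<^sup>2 + (v p)\<^sup>2)"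
    by simp
qed

lemma square_integrable_add:
  assumes "square_integrable u" "square_integrable v"
  shows "square_integrable (\<lambda>p. u p + v p)"
proof -
  have "integrable omega_measure (\<lambda>p. (u p)\<^sup>2 + (v p)\<^sup>2 + 2 * (u p * v p))"
    using assms square_integrable_mult[OF assms] by (simp add: square_integrable_def)
  then show ?thesis
    using assms by (auto simp: square_integrable_def power2_sum mult.assoc)
qed

lemma square_integrable_scale:
  assumes "square_integrable u"
  shows "square_integrable (\<lambda>p. c * u p)"
  using assms by (auto simp: square_integrable_def power_mult_distrib)

quotient_type L2 = "real \<times> real \<Rightarrow> real" / partial: L2_rel
  morphisms rep_L2 to_L2
proof (rule part_equivpI)
  show "\<exists>u. L2_rel u u"
    using square_integrable_zero by (auto simp: L2_rel_def)
  show "symp L2_rel"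
    by (auto simp: symp_def L2_rel_def elim: eventually_mono)
  show "transp L2_rel"
    by (auto simp: transp_def L2_rel_def elim: eventually_elim2)
qed

instantiation L2 :: real_inner
begin

lift_definition zero_L2 :: L2 is "\<lambda>p. 0"
  by (simp add: L2_rel_def square_integrable_zero)

lift_definition plus_L2 :: "L2 \<Rightarrow> L2 \<Rightarrow> L2" is "\<lambda>u v p. u p + v p"
  by (auto simp: L2_rel_def square_integrable_add elim: eventually_elim2)

lift_definition scaleR_L2 :: "real \<Rightarrow> L2 \<Rightarrow> L2" is "\<lambda>c u p. c * u p"
  by (auto simp: L2_rel_def square_integrable_scale elim: eventually_mono)

lift_definition uminus_L2 :: "L2 \<Rightarrow> L2" is "\<lambda>u p. - u p"
  using square_integrable_scale[of _ "-1"]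
  by (auto simp: L2_rel_def elim: eventually_mono)

lift_definition minus_L2 :: "L2 \<Rightarrow> L2 \<Rightarrow> L2" is "\<lambda>u v p. u p - v p"
proof -
  fix u u' v v' assume a: "L2_rel u u'" "L2_rel v v'"
  have "square_integrable (\<lambda>p. u p - v p)" if "square_integrable u" "square_integrable v" for u v
    using square_integrable_add[OF that(1) square_integrable_scale[OF that(2), of "-1"]] by simp
  with a show "L2_rel (\<lambda>p. u p - v p) (\<lambda>p. u' p - v' p)"
    by (auto simp: L2_rel_def elim: eventually_elim2)
qed

lift_definition inner_L2 :: "L2 \<Rightarrow> L2 \<Rightarrow> real" is
  "\<lambda>u v. integral\<^sup>L omega_measure (\<lambda>p. u p * v p)"
  by (rule integral_cong_AE) (auto simp: L2_rel_def square_integrable_def elim: eventually_elim2)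

definition norm_L2 :: "L2 \<Rightarrow> real" where
  "norm_L2 u = sqrt (inner u u)"

definition sgn_L2 :: "L2 \<Rightarrow> L2" where
  "sgn_L2 u = inverse (norm u) *\<^sub>R u"

definition dist_L2 :: "L2 \<Rightarrow> L2 \<Rightarrow> real" where
  "dist_L2 u v = norm (u - v)"

definition uniformity_L2 :: "(L2 \<times> L2) filter" where
  "uniformity_L2 = (INF e\<in>{0<..}. principal {(u, v). dist u v < e})"

definition open_L2 :: "L2 set \<Rightarrow> bool" where
  "open_L2 U \<longleftrightarrow> (\<forall>u\<in>U. \<forall>\<^sub>F (u', v) in uniformity. u' = u \<longrightarrow> v \<in> U)"

instance
proof
  fix a b c :: L2 and r s :: real
  show "a + b + c = a + (b + c)"
    by transfer (simp add: L2_rel_def square_integrable_add add.assoc)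
  show "a + b = b + a"
    by transfer (simp add: L2_rel_def square_integrable_add add.commute)
  show "0 + a = a"
    by transfer (simp add: L2_rel_def)
  show "- a + a = 0"
    by transfer (simp add: L2_rel_def square_integrable_zero)
  show "a - b = a + - b"
  proof transfer
    fix u v assume "L2_rel u u" "L2_rel v v"
    then show "L2_rel (\<lambda>p. u p - v p) (\<lambda>p. u p + - v p)"
      using square_integrable_add[OF _ square_integrable_scale, of u v "-1"]
      by (simp add: L2_rel_def)
  qed
  show "r *\<^sub>R (a + b) = r *\<^sub>R a + r *\<^sub>R b"
    using square_integrable_add square_integrable_scale
    by transfer (simp add: L2_rel_def distrib_left)
  show "(r + s) *\<^sub>R a = r *\<^sub>R a + s *\<^sub>R a"
    using square_integrable_add square_integrable_scale
    by transfer (simp add: L2_rel_def distrib_right)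
  show "r *\<^sub>R s *\<^sub>R a = (r * s) *\<^sub>R a"
    using square_integrable_scale
    by transfer (simp add: L2_rel_def mult.assoc)
  show "1 *\<^sub>R a = a"
    by transfer (simp add: L2_rel_def)
  show "sgn a = inverse (norm a) *\<^sub>R a"
    by (rule sgn_L2_def)
  show "dist a b = norm (a - b)"
    by (rule dist_L2_def)
  show "(uniformity :: (L2 \<times> L2) filter) = (INF e\<in>{0<..}. principal {(x, y). dist x y < e})"
    by (rule uniformity_L2_def)
  show "open U = (\<forall>x\<in>U. \<forall>\<^sub>F (x', y) in uniformity. x' = x \<longrightarrow> y \<in> U)" for U :: "L2 set"
    by (rule open_L2_def)
  show "inner a b = inner b a"
    by transfer (simp add: mult.commute)
  show "inner (a + b) c = inner a c + inner b c"
    by transfer (simp add: L2_rel_def distrib_right square_integrable_mult)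
  show "inner (r *\<^sub>R a) b = r * inner a b"
    by transfer (simp add: mult.assoc)
  show "0 \<le> inner a a"
    by transfer simp
  show "(inner a a = 0) = (a = 0)"
  proof transfer
    fix u assume u: "L2_rel u u"
    then have "integrable omega_measure (\<lambda>p. u p * u p)"
      by (simp add: L2_rel_def square_integrable_mult)
    then have "(integral\<^sup>L omega_measure (\<lambda>p. u p * u p) = 0) =
        (AE p in omega_measure. u p * u p = 0)"
      by (rule integral_nonneg_eq_0_iff_AE) simp
    then show "(integral\<^sup>L omega_measure (\<lambda>p. u p * u p) = 0) = L2_rel u (\<lambda>p. 0)"
      using u by (simp add: L2_rel_def square_integrable_zero)
  qed
  show "norm a = sqrt (inner a a)"
    by (rule norm_L2_def)
qed

end

lemma norm_to_L2:
  assumes "square_integrable u"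
  shows "norm (to_L2 u) = sqrt (integral\<^sup>L omega_measure (\<lambda>p. (u p)\<^sup>2))"
  using assms
  by (simp add: norm_L2_def inner_L2.abs_eq L2_rel_def power2_eq_square)

definition partial_t :: "(real \<times> real \<Rightarrow> real) \<Rightarrow> real \<times> real \<Rightarrow> real" where
  "partial_t f = (\<lambda>(t, x). deriv (\<lambda>s. f (s, x)) t)"

definition partial_x :: "(real \<times> real \<Rightarrow> real) \<Rightarrow> real \<times> real \<Rightarrow> real" where
  "partial_x f = (\<lambda>(t, x). deriv (\<lambda>y. f (t, y)) x)"

primrec C_k :: "nat \<Rightarrow> (real \<times> real \<Rightarrow> real) \<Rightarrow> bool" where
  "C_k 0 f \<longleftrightarrow> continuous_on UNIV f"
| "C_k (Suc k) f \<longleftrightarrow> (\<forall>p. f differentiable (at p)) \<and> C_k k (partial_t f) \<and> C_k k (partial_x f)"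

text \<open>The total differentiability clause follows from the existence and continuity
  of the partial derivatives; it also guarantees that \<^const>\<open>deriv\<close> is a genuine derivative.\<close>

definition smooth :: "(real \<times> real \<Rightarrow> real) \<Rightarrow> bool" where
  "smooth f \<longleftrightarrow> (\<forall>k. C_k k f)"

text \<open>Elements of \<open>C_c\<^sup>\<infinity>(U)\<close> for open \<open>U\<close> are identified with their extensions by zero to the
  whole plane.\<close>

definition Cc_infinity :: "(real \<times> real) set \<Rightarrow> (real \<times> real \<Rightarrow> real) set" where
  "Cc_infinity U = {\<phi>. smooth \<phi> \<and> compact (closure {p. \<phi> p \<noteq> 0}) \<and> closure {p. \<phi> p \<noteq> 0} \<subseteq> U}"

definition u0 :: "real \<Rightarrow> real" where
  "u0 x = (if x < 0 then 1 else - 1)"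

definition distributional_solution :: "real \<Rightarrow> (real \<times> real \<Rightarrow> real) \<Rightarrow> bool" where
  "distributional_solution \<mu> u \<longleftrightarrow>
     square_integrable u \<and>
     (\<forall>\<phi> \<in> Cc_infinity ({..<1} \<times> UNIV).
        (\<forall>t\<in>{0..<1}. \<phi> (t, -1) = 0 \<and> \<phi> (t, 1) = 0) \<longrightarrow>
        (LBINT t=0..1. (LBINT x=(-1)..1.
            u (t, x) * (partial_t (partial_t \<phi>) (t, x) - \<mu>\<^sup>2 * partial_x (partial_x \<phi>) (t, x))))
        + (LBINT x=(-1)..1. u0 x * partial_t \<phi> (0, x))
        - \<mu>\<^sup>2 * (LBINT t=0..1. partial_x \<phi> (t, 1) + partial_x \<phi> (t, -1)) = 0)"

definition solution_manifold :: "L2 set" where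
  "solution_manifold = {to_L2 u |u \<mu>. \<mu> \<in> {0..1} \<and> distributional_solution \<mu> u}"

end

theory Submission
  imports Defs
begin

text \<open>For \<open>0 \<le> \<mu> \<le> 1\<close> the waves issuing from the jump at \<open>x = 0\<close> do not reach the boundary, so d'Alembert's
  formula \<open>(u\<^sub>0(x - \<mu>t) + u\<^sub>0(x + \<mu>t)) / 2\<close> solves the problem.  With \<open>\<mu>\<^sub>k = k / 2N\<close>, consecutive
  solutions differ on disjoint pairs of wedges, each pair of area \<open>1 / 2N\<close>; hence the \<open>2N\<close> differences are
  orthogonal with norm \<open>1 / \<surd>(2N)\<close>.  By Bessel's inequality, one of them has distance at
  least \<open>1 / (2\<surd>N)\<close> from a given \<open>N\<close>-dimensional subspace, and by the triangle inequality one of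
  the two solutions has at least half that distance.\<close>

subsection \<open>Orthogonal families and finite-dimensional subspaces\<close>

text \<open>Cauchy-Schwarz is applied to \<open>b\<close> and \<open>p\<close>, the sum of the
  vectors \<open>(e k \<bullet> b) *\<^sub>R e k\<close>. With \<open>s\<close> for the left-hand
  side, \<open>p \<bullet> b = s\<close> and \<open>p \<bullet> p = r\<^sup>2 * s\<close>, and a
  factor \<open>s\<close> cancels. The common norm \<open>r\<close> instead of 1 spares a
  normalisation of the wave differences.\<close>

lemma bessel_inequality:
  fixes e :: "'i \<Rightarrow> 'a::real_inner"
  assumes fin: "finite A" and r: "\<And>k. k \<in> A \<Longrightarrow> norm (e k) = r"
    and orth: "\<And>j k. j \<in> A \<Longrightarrow> k \<in> A \<Longrightarrow> j \<noteq> k \<Longrightarrow> e j \<bullet> e k = 0"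
  shows "(\<Sum>k\<in>A. (e k \<bullet> b)\<^sup>2) \<le> r\<^sup>2 * (norm b)\<^sup>2"
proof -
  define p where "p = (\<Sum>k\<in>A. (e k \<bullet> b) *\<^sub>R e k)"
  define s where "s = (\<Sum>k\<in>A. (e k \<bullet> b)\<^sup>2)"
  have pb: "p \<bullet> b = s"
    by (simp add: p_def s_def inner_sum_left power2_eq_square)
  have "p \<bullet> e k = (e k \<bullet> b) * r\<^sup>2" if "k \<in> A" for k
  proof -
    have "p \<bullet> e k = (\<Sum>j\<in>A. if j = k then (e k \<bullet> b) * r\<^sup>2 else 0)"
      unfolding p_def inner_sum_left
      by (rule sum.cong) (use that orth r in \<open>auto simp: power2_norm_eq_inner[symmetric]\<close>)
    then show ?thesis using fin that by simp
  qed
  then have pp: "p \<bullet> p = r\<^sup>2 * s"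
    by (subst (2) p_def) (simp add: inner_sum_right s_def sum_distrib_left power2_eq_square mult_ac)
  have s0: "0 \<le> s" by (simp add: s_def sum_nonneg)
  have "s\<^sup>2 \<le> (p \<bullet> p) * (b \<bullet> b)"
    using Cauchy_Schwarz_ineq[of p b] pb by simp
  then have "s * s \<le> s * (r\<^sup>2 * (norm b)\<^sup>2)"
    unfolding power2_norm_eq_inner[of b] by (simp add: pp power2_eq_square mult_ac)
  then show ?thesis
    using s0 by (cases "s = 0") (auto simp: s_def[symmetric])
qed

text \<open>Pythagoras with the orthogonal projection \<open>p\<close> of \<open>x\<close> onto
  \<open>span C\<close>: the right side exceeds the left by the square of
  \<open>norm (p - v)\<close>.\<close>

lemma norm_diff_span_orthogonal_ge:
  fixes x :: "'a::real_inner"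
  assumes fin: "finite C" and orth: "pairwise orthogonal C" and v: "v \<in> span C"
  shows "(norm x)\<^sup>2 - (\<Sum>b\<in>C. (x \<bullet> b)\<^sup>2 / (norm b)\<^sup>2) \<le> (norm (x - v))\<^sup>2"
proof -
  \<comment> \<open>\<open>C\<close> may contain the zero vector; its coefficient is then 0 / 0 = 0,
    and \<open>p \<bullet> b = x \<bullet> b\<close> still holds there.\<close>
  define p where "p = (\<Sum>b\<in>C. ((x \<bullet> b) / (norm b)\<^sup>2) *\<^sub>R b)"
  have pC: "p \<bullet> b = x \<bullet> b" if "b \<in> C" for b
  proof -
    have "p \<bullet> b = (\<Sum>c\<in>C. if c = b then x \<bullet> b else 0)"
      unfolding p_def inner_sum_left
      by (rule sum.cong)
        (use that orth in \<open>auto simp: pairwise_def orthogonal_def power2_norm_eq_inner\<close>)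
    then show ?thesis using fin that by simp
  qed
  have perp: "(x - p) \<bullet> w = 0" if "w \<in> span C" for w
    using orthogonal_to_span[OF that, of "x - p"] pC
    by (auto simp: orthogonal_def inner_diff_left)
  have p_in: "p \<in> span C"
    unfolding p_def by (intro span_sum span_mul span_base)
  have xp: "x \<bullet> p = (\<Sum>b\<in>C. (x \<bullet> b)\<^sup>2 / (norm b)\<^sup>2)"
    by (simp add: p_def inner_sum_right power2_eq_square)
  have "(norm (x - v))\<^sup>2 = (norm (x - p))\<^sup>2 + (norm (p - v))\<^sup>2"
    using perp[OF span_diff[OF p_in v]]
    norm_add_Pythagorean[of "x - p" "p - v"] by (simp add: orthogonal_def)
  moreover have "(norm (x - p))\<^sup>2 = (norm x)\<^sup>2 - x \<bullet> p"
    using perp[OF p_in] by (simp add: power2_norm_eq_inner inner_diff_left inner_diff_right inner_commute)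
  ultimately show ?thesis by (simp add: xp)
qed

text \<open>An averaging argument. Let \<open>g k\<close> be the squared length of the projection of
  \<open>e k\<close> onto \<open>span C\<close>, which contains \<open>V\<close>. After swapping
  sums, Bessel's inequality bounds the contribution of each \<open>b\<close> in \<open>C\<close> by
  \<open>r\<^sup>2\<close>, so the \<open>g k\<close> add up to at most
  \<open>dim V * r\<^sup>2\<close> and some \<open>g k\<close> is at most the average.\<close>

lemma orthogonal_family_far_from_subspace:
  fixes e :: "'i \<Rightarrow> 'a::real_inner"
  assumes fin: "finite A" and ne: "A \<noteq> {}" and r: "\<And>k. k \<in> A \<Longrightarrow> norm (e k) = r"
    and orth: "\<And>j k. j \<in> A \<Longrightarrow> k \<in> A \<Longrightarrow> j \<noteq> k \<Longrightarrow> e j \<bullet> e k = 0"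
    and V: "subspace V" "finite B" "span B = V"
  obtains k where "k \<in> A"
    "\<And>v. v \<in> V \<Longrightarrow> r\<^sup>2 * (1 - real (dim V) / real (card A)) \<le> (norm (e k - v))\<^sup>2"
proof -
  obtain B' where B': "B' \<subseteq> V" "independent B'" "V \<subseteq> span B'" "card B' = dim V"
    using basis_exists by blast
  have "finite B'"
    using independent_span_bound[OF V(2) B'(2)] B'(1) V(3) by auto
  then obtain C where C: "finite C" "card C \<le> card B'" "span C = span B'" "pairwise orthogonal C"
    using basis_orthogonal by blast
  have VC: "V \<subseteq> span C" using B' C by simp
  define g where "g k = (\<Sum>b\<in>C. (e k \<bullet> b)\<^sup>2 / (norm b)\<^sup>2)" for k
  have "(\<Sum>k\<in>A. g k) = (\<Sum>b\<in>C. (\<Sum>k\<in>A. (e k \<bullet> b)\<^sup>2) / (norm b)\<^sup>2)"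
    unfolding g_def by (subst sum.swap) (simp add: sum_divide_distrib)
  also have "\<dots> \<le> (\<Sum>b\<in>C. r\<^sup>2)"
  proof (rule sum_mono)
    fix b
    show "(\<Sum>k\<in>A. (e k \<bullet> b)\<^sup>2) / (norm b)\<^sup>2 \<le> r\<^sup>2"
      using bessel_inequality[OF fin r orth, where b = b]
      by (cases "b = 0") (auto simp: divide_le_eq)
  qed
  also have "\<dots> \<le> real (dim V) * r\<^sup>2"
    using C(2) B'(4) by (auto intro!: mult_right_mono)
  finally have sum: "(\<Sum>k\<in>A. g k) \<le> real (dim V) * r\<^sup>2" .
  have "\<exists>k\<in>A. g k \<le> real (dim V) * r\<^sup>2 / real (card A)"
  proof (rule ccontr)
    assume "\<not> ?thesis"
    then have "(\<Sum>k\<in>A. real (dim V) * r\<^sup>2 / real (card A)) < (\<Sum>k\<in>A. g k)"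
      using fin ne by (intro sum_strict_mono) auto
    then show False using sum fin ne by simp
  qed
  then obtain k where k: "k \<in> A" "g k \<le> real (dim V) * r\<^sup>2 / real (card A)" ..
  show ?thesis
  proof
    show "k \<in> A" by fact
    fix v assume "v \<in> V"
    then have "(norm (e k))\<^sup>2 - g k \<le> (norm (e k - v))\<^sup>2"
      unfolding g_def using VC by (intro norm_diff_span_orthogonal_ge C) auto
    then show "r\<^sup>2 * (1 - real (dim V) / real (card A)) \<le> (norm (e k - v))\<^sup>2"
      using k r[OF k(1)] by (simp add: algebra_simps)
  qed
qed

subsection \<open>The d'Alembert solutions in \<open>L\<^sub>2\<close>\<close>

text \<open>\<open>u0\<close> is constant on each side of 0, also beyond the interval (-1, 1), so
  the formula takes the prescribed boundary values as long as \<open>\<mu> * t < 1\<close>, without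
  any reflected waves.\<close>

definition wave :: "real \<Rightarrow> real \<times> real \<Rightarrow> real" where
  "wave \<mu> = (\<lambda>(t, x). (u0 (x - \<mu> * t) + u0 (x + \<mu> * t)) / 2)"

lemma u0_measurable [measurable]: "u0 \<in> borel_measurable borel"
  unfolding u0_def by measurable

lemma wave_measurable: "wave \<mu> \<in> borel_measurable borel"
  unfolding wave_def borel_prod[symmetric] by measurable

lemma Omega_borel: "Omega \<in> sets borel"
  unfolding Omega_def by (intro borel_open open_Times) auto

lemma emeasure_Omega: "emeasure lborel Omega = 2"
proof -
  have "emeasure (lborel \<Otimes>\<^sub>M lborel) Omega = emeasure lborel {0<..<1::real} * emeasure lborel {-1<..<1::real}"
    unfolding Omega_def by (rule lborel.emeasure_pair_measure_Times) auto
  then show ?thesis by (simp add: lborel_prod)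
qed

lemma square_integrable_wave: "square_integrable (wave \<mu>)"
proof -
  have m: "(\<lambda>p. (wave \<mu> p)\<^sup>2) \<in> borel_measurable borel"
    using wave_measurable by measurable
  have "integrable lborel (\<lambda>p. indicator Omega p *\<^sub>R (wave \<mu> p)\<^sup>2)"
  proof (rule Bochner_Integration.integrable_bound)
    show "integrable lborel (indicat_real Omega)"
      using Omega_borel by (simp add: emeasure_Omega)
    show "(\<lambda>p. indicator Omega p *\<^sub>R (wave \<mu> p)\<^sup>2) \<in> borel_measurable lborel"
      using Omega_borel m by measurable
    have "(wave \<mu> p)\<^sup>2 \<le> 1" for p
      by (cases p) (simp add: wave_def u0_def)
    then show "AE p in lborel. norm (indicator Omega p *\<^sub>R (wave \<mu> p)\<^sup>2) \<le> norm (indicat_real Omega p)"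
      by (intro AE_I2) (simp add: indicator_def)
  qed
  moreover have "wave \<mu> \<in> borel_measurable omega_measure"
    unfolding omega_measure_def by (rule measurable_restrict_space1) (simp add: wave_measurable)
  ultimately show ?thesis
    using Omega_borel
    by (simp add: square_integrable_def omega_measure_def integrable_restrict_space)
qed

text \<open>For c \<ge> 0, \<open>wave c (t, x)\<close> is 0 when
  \<open>- (c * t) \<le> x < c * t\<close> and \<open>u0 x\<close> otherwise. The difference
  therefore lives where the wider fan has already cancelled and the narrower one has not; the
  half-open bounds reflect \<open>u0 0 = - 1\<close>.\<close>

lemma wave_diff:
  assumes "0 \<le> a" "a \<le> b" "(t, x) \<in> Omega"
  shows "wave a (t, x) - wave b (t, x) =
    (if - (b * t) \<le> x \<and> x < - (a * t) \<or> a * t \<le> x \<and> x < b * t then u0 x else 0)"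
proof -
  have "0 \<le> a * t" using assms by (simp add: Omega_def)
  have "a * t \<le> b * t" using assms by (auto simp: Omega_def intro!: mult_right_mono)
  then show ?thesis using \<open>0 \<le> a * t\<close> by (auto simp: wave_def u0_def)
qed

lemma inner_to_L2:
  assumes "square_integrable u" "square_integrable v"
  shows "inner (to_L2 u) (to_L2 v) = (LINT p|lborel. indicator Omega p *\<^sub>R (u p * v p))"
  using assms Omega_borel
  by (simp add: inner_L2.abs_eq L2_rel_def omega_measure_def integral_restrict_space)

lemma square_integrable_wave_diff: "square_integrable (\<lambda>p. wave a p - wave b p)"
  using square_integrable_add[OF square_integrable_wave square_integrable_scale[OF square_integrable_wave, of "-1"]]
  by simp

lemma to_L2_wave_diff: "to_L2 (wave a) - to_L2 (wave b) = to_L2 (\<lambda>p. wave a p - wave b p)"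
  by (simp add: minus_L2.abs_eq L2_rel_def square_integrable_wave)

text \<open>As b \<le> c, the wedges supporting the two differences are disjoint, and the product
  vanishes pointwise on \<open>Omega\<close>.\<close>

lemma inner_wave_diff_disjoint:
  assumes "0 \<le> a" "a \<le> b" "b \<le> c" "c \<le> d"
  shows "inner (to_L2 (wave a) - to_L2 (wave b)) (to_L2 (wave c) - to_L2 (wave d)) = 0"
proof -
  have "(LINT p|lborel. indicator Omega p *\<^sub>R ((wave a p - wave b p) * (wave c p - wave d p))) = (LINT p|(lborel :: (real \<times> real) measure). 0)"
  proof (rule Bochner_Integration.integral_cong)
    fix p :: "real \<times> real"
    obtain t x where p: "p = (t, x)" by force
    show "indicator Omega p *\<^sub>R ((wave a p - wave b p) * (wave c p - wave d p)) = 0"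
    proof (cases "p \<in> Omega")
      case True
      then have "0 \<le> a * t" "a * t \<le> b * t" "b * t \<le> c * t" "c * t \<le> d * t"
        using assms by (auto simp: p Omega_def intro!: mult_right_mono)
      then show ?thesis using True assms by (auto simp: p wave_diff)
    qed simp
  qed simp
  then show ?thesis
    by (simp add: to_L2_wave_diff inner_to_L2 square_integrable_wave_diff)
qed

text \<open>Since \<open>u0\<close> has modulus 1, the squared difference is the indicator of the
  wedge pair \<open>D\<close>. At time \<open>t\<close> its slice consists of two intervals of
  length \<open>(b - a) * t\<close>, and integrating over (0, 1) gives area
  \<open>b - a\<close>.\<close>

lemma norm_wave_diff:
  assumes ab: "0 \<le> a" "a \<le> b" "b \<le> 1"
  shows "(norm (to_L2 (wave a) - to_L2 (wave b)))\<^sup>2 = b - a"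
proof -
  define D where "D = {(t, x). (t, x) \<in> Omega \<and>
    (- (b * t) \<le> x \<and> x < - (a * t) \<or> a * t \<le> x \<and> x < b * t)}"
  have D: "D \<in> sets (borel \<Otimes>\<^sub>M borel)"
  proof -
    have "D = Omega \<inter> {p \<in> space (borel \<Otimes>\<^sub>M borel).
      - (b * fst p) \<le> snd p \<and> snd p < - (a * fst p) \<or> a * fst p \<le> snd p \<and> snd p < b * fst p}"
      by (auto simp: D_def space_pair_measure)
    also have "\<dots> \<in> sets (borel \<Otimes>\<^sub>M borel)"
      by (rule sets.Int) (use Omega_borel in \<open>auto simp: borel_prod[symmetric]\<close>)
    finally show ?thesis .
  qed
  \<comment> \<open>The closed interval on the right is the form that
    \<open>nn_integral_FTC_Icc\<close> expects. At \<open>t = 1\<close> the slice of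
    \<open>D\<close> is empty while the formula need not vanish, so the endpoints are set aside as a
    null set.\<close>
  have slice: "emeasure lborel (Pair t -` D) = ennreal (2 * (b - a) * t) * indicator {0..1} t"
    if "t \<noteq> 0" "t \<noteq> 1" for t
  proof (cases "0 < t \<and> t < 1")
    case True
    have le: "0 \<le> a * t" "a * t \<le> b * t" using True ab by (auto intro: mult_right_mono)
    \<comment> \<open>The bound b \<le> 1 keeps the wedges from being cut off by the boundary of
      \<open>Omega\<close>.\<close>
    have "b * t \<le> 1 * t" using True ab by (intro mult_right_mono) auto
    with True have "b * t < 1" by linarith
    then have "Pair t -` D = {- (b * t)..<- (a * t)} \<union> {a * t..<b * t}"
      using True le by (auto simp: D_def Omega_def)
    moreover have "emeasure lborel ({- (b * t)..<- (a * t)} \<union> {a * t..<b * t})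
      = emeasure lborel {- (b * t)..<- (a * t)} + emeasure lborel {a * t..<b * t}"
      by (rule plus_emeasure[symmetric]) (use le in auto)
    ultimately show ?thesis
      using True le by (simp add: ennreal_plus[symmetric] algebra_simps del: ennreal_plus)
  next
    case False
    then have "Pair t -` D = {}" using that by (auto simp: D_def Omega_def)
    with False that show ?thesis by (auto simp: indicator_def)
  qed
  have "emeasure lborel D = (\<integral>\<^sup>+ t. emeasure lborel (Pair t -` D) \<partial>lborel)"
    using lborel.emeasure_pair_measure_alt[of D lborel] D by (simp add: lborel_prod)
  also have "\<dots> = (\<integral>\<^sup>+ t. ennreal (2 * (b - a) * t) * indicator {0..1} t \<partial>lborel)"
    using AE_lborel_singleton[of "0::real"] AE_lborel_singleton[of "1::real"]
    by (intro nn_integral_cong_AE, eventually_elim) (rule slice)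
  also have "\<dots> = ennreal ((b - a) * 1\<^sup>2 - (b - a) * 0\<^sup>2)"
    by (rule nn_integral_FTC_Icc[where F = "\<lambda>t. (b - a) * t\<^sup>2"])
      (use ab in \<open>auto intro!: derivative_eq_intros\<close>)
  finally have meas: "measure lborel D = b - a"
    using ab by (simp add: measure_def)
  have "(norm (to_L2 (wave a) - to_L2 (wave b)))\<^sup>2 =
      (LINT p|lborel. indicator Omega p *\<^sub>R ((wave a p - wave b p) * (wave a p - wave b p)))"
    by (simp add: to_L2_wave_diff inner_to_L2 square_integrable_wave_diff power2_norm_eq_inner)
  also have "\<dots> = (LINT p|lborel. indicat_real D p)"
  proof (rule Bochner_Integration.integral_cong)
    fix p :: "real \<times> real"
    obtain t x where p: "p = (t, x)" by force
    show "indicator Omega p *\<^sub>R ((wave a p - wave b p) * (wave a p - wave b p)) = indicat_real D p"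
      using ab wave_diff[of a b t x] by (auto simp: p indicator_def D_def u0_def)
  qed simp
  finally show ?thesis by (simp add: meas)
qed

subsection \<open>The wave identity on a half strip\<close>

text \<open>Dominated by \<open>g\<close> on the closed unit square, where a continuous function is
  integrable. The two nested indicators make the Fubini lemmas yield iterated interval integrals
  directly.\<close>

lemma integrable_wedge:
  fixes g :: "real \<times> real \<Rightarrow> real"
  assumes g: "continuous_on UNIV g"
  shows "integrable (lborel \<Otimes>\<^sub>M lborel)
    (\<lambda>(t, x). indicat_real {0<..<1} t *\<^sub>R (indicat_real {0<..<1} x *\<^sub>R (if \<mu> * t \<le> x then g (t, x) else 0)))"
proof (rule Bochner_Integration.integrable_bound)
  have [measurable]: "g \<in> borel_measurable (borel \<Otimes>\<^sub>M borel)"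
    using borel_measurable_continuous_onI[OF g] by (simp add: borel_prod)
  show "integrable (lborel \<Otimes>\<^sub>M lborel) (\<lambda>p. indicator (cbox (0, 0) (1, 1)) p *\<^sub>R g p)"
    unfolding lborel_prod
    by (rule borel_integrable_compact[OF compact_cbox continuous_on_subset[OF g]]) simp
  show "(\<lambda>(t, x). indicat_real {0<..<1} t *\<^sub>R (indicat_real {0<..<1} x *\<^sub>R (if \<mu> * t \<le> x then g (t, x) else 0)))
      \<in> borel_measurable (lborel \<Otimes>\<^sub>M lborel)"
    by measurable
  show "AE p in lborel \<Otimes>\<^sub>M lborel.
    norm (case p of (t, x) \<Rightarrow> indicat_real {0<..<1} t *\<^sub>R (indicat_real {0<..<1} x *\<^sub>R (if \<mu> * t \<le> x then g (t, x) else 0)))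
    \<le> norm (indicator (cbox (0, 0) (1, 1)) p *\<^sub>R g p)"
    by (rule AE_I2) (auto simp: indicator_def split: if_splits)
qed

lemma interval_integral_unit:
  "(LBINT x=0..1. f x) = (LINT x|lborel. indicator {0<..<1} x *\<^sub>R (f x :: real))"
  by (simp add: interval_lebesgue_integral_def set_lebesgue_integral_def zero_ereal_def one_ereal_def)

lemma interval_integrable_unit:
  "interval_lebesgue_integrable lborel 0 1 f = integrable lborel (\<lambda>x. indicator {0<..<1} x *\<^sub>R (f x :: real))"
  by (simp add: interval_lebesgue_integrable_def set_integrable_def zero_ereal_def one_ereal_def)

lemma interval_integrable_unit_continuous:
  fixes f :: "real \<Rightarrow> real"
  assumes "continuous_on UNIV f"
  shows "interval_lebesgue_integrable lborel 0 1 f"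
  unfolding zero_ereal_def one_ereal_def
  by (rule interval_integrable_continuous_on) (auto intro: continuous_on_subset[OF assms])

lemma wedge_Fubini:
  fixes g :: "real \<times> real \<Rightarrow> real"
  assumes g: "continuous_on UNIV g"
  shows "interval_lebesgue_integrable lborel 0 1 (\<lambda>t. LBINT x=0..1. (if \<mu> * t \<le> x then g (t, x) else 0))"
    "(LBINT t=0..1. (LBINT x=0..1. (if \<mu> * t \<le> x then g (t, x) else 0))) =
     (LBINT x=0..1. (LBINT t=0..1. (if \<mu> * t \<le> x then g (t, x) else 0)))"
proof -
  note I = integrable_wedge[OF g, of \<mu>]
  show "interval_lebesgue_integrable lborel 0 1 (\<lambda>t. LBINT x=0..1. (if \<mu> * t \<le> x then g (t, x) else 0))"
    using lborel_pair.integrable_fst'[OF I] by (simp add: interval_integral_unit interval_integrable_unit)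
  show "(LBINT t=0..1. (LBINT x=0..1. (if \<mu> * t \<le> x then g (t, x) else 0))) =
     (LBINT x=0..1. (LBINT t=0..1. (if \<mu> * t \<le> x then g (t, x) else 0)))"
    using lborel_pair.Fubini_integral[OF I]
    by (simp add: interval_integral_unit mult.left_commute flip: integral_mult_right_zero)
qed

text \<open>Fubini would give this only for almost every \<open>t\<close>; domination by the
  continuous slice gives it for all \<open>t\<close>.\<close>

lemma wedge_integrable_x:
  fixes g :: "real \<times> real \<Rightarrow> real"
  assumes g: "continuous_on UNIV g"
  shows "interval_lebesgue_integrable lborel 0 1 (\<lambda>x. if \<mu> * t \<le> x then g (t, x) else 0)"
proof -
  have c: "continuous_on UNIV (\<lambda>x. g (t, x))"
    by (rule continuous_on_compose2[OF g]) (auto intro!: continuous_intros)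
  then have [measurable]: "(\<lambda>x. g (t, x)) \<in> borel_measurable borel"
    by (rule borel_measurable_continuous_onI)
  show ?thesis
    using interval_integrable_unit_continuous[OF c]
    unfolding interval_integrable_unit
    by (rule Bochner_Integration.integrable_bound) (auto split: if_splits)
qed

lemma interval_integral_FTC_real:
  fixes F f :: "real \<Rightarrow> real"
  assumes "continuous_on UNIV f" "\<And>x. (F has_real_derivative f x) (at x)"
  shows "(LBINT x=ereal a..ereal b. f x) = F b - F a"
  using assms by (intro interval_integral_FTC_finite)
    (auto intro: continuous_on_subset DERIV_subset
      simp: has_real_derivative_iff_has_vector_derivative[symmetric])

text \<open>Leaving out the points \<open>a\<close> and \<open>b\<close>, a null set, lets
  integrands defined with \<le> or with < be treated alike.\<close>

lemma interval_integral_restrict: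
  fixes f :: "real \<Rightarrow> real"
  assumes "0 \<le> a" "a \<le> b" "b \<le> 1"
    and "\<And>x. 0 < x \<Longrightarrow> x < 1 \<Longrightarrow> x \<noteq> a \<Longrightarrow> x \<noteq> b \<Longrightarrow> g x = (if a < x \<and> x < b then f x else 0)"
  shows "(LBINT x=0..1. g x) = (LBINT x=ereal a..ereal b. f x)"
proof -
  have "(LINT x|lborel. indicator {0<..<1} x *\<^sub>R g x) = (LINT x|lborel. indicator {a<..<b} x *\<^sub>R f x)"
    by (rule integral_discrete_difference[where X = "{a, b}"])
      (use assms in \<open>auto simp: indicator_def\<close>)
  then show ?thesis
    unfolding interval_integral_unit
    using assms by (simp add: interval_lebesgue_integral_le_eq set_lebesgue_integral_def)
qed

text \<open>The second-order terms are integrated along \<open>t\<close> and along \<open>x\<close> respectively; the two contributions of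
  the characteristic \<open>x = \<mu>t\<close> add up to the derivative of \<open>f\<close> along it.\<close>

lemma half_wave_identity:
  fixes f ft fx ftt fxx :: "real \<times> real \<Rightarrow> real"
  assumes mu: "0 \<le> \<mu>" "\<mu> \<le> 1"
    and cont: "continuous_on UNIV ft" "continuous_on UNIV fx" "continuous_on UNIV ftt" "continuous_on UNIV fxx"
    and dtt: "\<And>t x. ((\<lambda>s. ft (s, x)) has_real_derivative ftt (t, x)) (at t)"
    and dxx: "\<And>t x. ((\<lambda>y. fx (t, y)) has_real_derivative fxx (t, x)) (at x)"
    and dchar: "\<And>s. ((\<lambda>s. f (s, \<mu> * s)) has_real_derivative ft (s, \<mu> * s) + \<mu> * fx (s, \<mu> * s)) (at s)"
    and end_time: "f (1, \<mu>) = 0" "\<And>x. ft (1, x) = 0"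
  defines "R \<equiv> \<lambda>t. LBINT x=0..1. (if \<mu> * t \<le> x then ftt (t, x) - \<mu>\<^sup>2 * fxx (t, x) else 0)"
  shows "interval_lebesgue_integrable lborel 0 1 R"
    and "(LBINT t=0..1. R t) =
      - \<mu> * f (0, 0) - (LBINT x=0..1. ft (0, x)) - \<mu>\<^sup>2 * (LBINT t=0..1. fx (t, 1))"
proof -
  define A where "A t = (LBINT x=0..1. (if \<mu> * t \<le> x then ftt (t, x) else 0))" for t
  define B where "B t = fx (t, 1) - fx (t, \<mu> * t)" for t
  have cont_comp: "continuous_on UNIV (\<lambda>s. h (p s, q s))"
    if "continuous_on UNIV h" "continuous_on UNIV p" "continuous_on UNIV q"
    for h :: "real \<times> real \<Rightarrow> real" and p q :: "real \<Rightarrow> real"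
    by (rule continuous_on_compose2[OF that(1)]) (auto intro!: continuous_intros that)
  \<comment> \<open>At fixed \<open>t\<close> the integration in space runs from the characteristic
    \<open>x = \<mu> * t\<close> to the boundary \<open>x = 1\<close>.\<close>
  have B: "(LBINT x=0..1. (if \<mu> * t \<le> x then fxx (t, x) else 0)) = B t" if t: "0 < t" "t < 1" for t
  proof -
    have "\<mu> * t \<le> 1 * 1" using mu t by (intro mult_mono) auto
    then have "(LBINT x=0..1. (if \<mu> * t \<le> x then fxx (t, x) else 0)) =
        (LBINT x=ereal (\<mu> * t)..ereal 1. fxx (t, x))"
      using mu t by (intro interval_integral_restrict) auto
    also have "\<dots> = B t"
      unfolding B_def
      by (rule interval_integral_FTC_real) (auto intro!: cont_comp cont dxx continuous_intros)
    finally show ?thesis .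
  qed
  have R: "R t = A t - \<mu>\<^sup>2 * B t" if t: "0 < t" "t < 1" for t
  proof -
    have "R t = (LBINT x=0..1. (if \<mu> * t \<le> x then ftt (t, x) else 0)
        - \<mu>\<^sup>2 * (if \<mu> * t \<le> x then fxx (t, x) else 0))"
      unfolding R_def by (rule interval_integral_cong) auto
    also have "\<dots> = A t - \<mu>\<^sup>2 * B t"
      by (subst interval_lebesgue_integral_diff)
        (auto simp: A_def B[OF t] intro!: wedge_integrable_x cont)
    finally show ?thesis .
  qed
  have intA: "interval_lebesgue_integrable lborel 0 1 A"
    unfolding A_def by (rule wedge_Fubini) fact
  have intB: "interval_lebesgue_integrable lborel 0 1 B"
    unfolding B_def
    by (intro interval_integrable_unit_continuous continuous_intros cont_comp cont)
  have "interval_lebesgue_integrable lborel 0 1 (\<lambda>t. A t - \<mu>\<^sup>2 * B t)"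
    using intA intB by simp
  also have "?this \<longleftrightarrow> interval_lebesgue_integrable lborel 0 1 R"
    unfolding interval_integrable_unit
    by (rule Bochner_Integration.integrable_cong) (auto simp: R indicator_def)
  finally show "interval_lebesgue_integrable lborel 0 1 R" .
  have "(LBINT t=0..1. R t) = (LBINT t=0..1. A t - \<mu>\<^sup>2 * B t)"
    by (rule interval_integral_cong) (auto simp: R einterval_iff zero_ereal_def one_ereal_def)
  also have "\<dots> = (LBINT t=0..1. A t) - \<mu>\<^sup>2 * (LBINT t=0..1. B t)"
    using intA intB by simp
  also have "(LBINT t=0..1. B t) = (LBINT t=0..1. fx (t, 1)) - (LBINT t=0..1. fx (t, \<mu> * t))"
    unfolding B_def
    by (intro interval_lebesgue_integral_diff interval_integrable_unit_continuous continuous_intros cont_comp cont)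
  also have "(LBINT t=0..1. A t) =
      \<mu> * (LBINT s=0..1. ft (s, \<mu> * s)) - (LBINT x=0..1. ft (0, x))"
  proof -
    \<comment> \<open>\<open>h x\<close> is the value of \<open>ft\<close> where the line of fixed
      \<open>x\<close> meets the characteristic, at time \<open>x / \<mu>\<close>. For x \<ge> \<mu>
      that does not happen before time 1, where \<open>ft\<close> vanishes. With \<mu> = 0 the
      second case applies to every x > 0.\<close>
    define h where "h x = (if x < \<mu> then ft (x / \<mu>, x) else 0)" for x
    have "(LBINT t=0..1. A t) = (LBINT x=0..1. (LBINT t=0..1. (if \<mu> * t \<le> x then ftt (t, x) else 0)))"
      unfolding A_def by (rule wedge_Fubini) fact
    also have "\<dots> = (LBINT x=0..1. h x - ft (0, x))"
    proof (rule interval_integral_cong)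
      fix x :: real assume "x \<in> einterval (min 0 1) (max 0 1)"
      then have x: "0 < x" "x < 1" by (auto simp: einterval_iff zero_ereal_def one_ereal_def)
      \<comment> \<open>The time at which the line of fixed \<open>x\<close> leaves the region
        \<open>\<mu> * t \<le> x\<close>, or 1 if it stays inside until the end.\<close>
      define \<tau> where "\<tau> = (if x < \<mu> then x / \<mu> else 1)"
      have \<tau>: "0 \<le> \<tau>" "\<tau> \<le> 1" using x mu by (auto simp: \<tau>_def divide_le_eq)
      have "(LBINT t=0..1. (if \<mu> * t \<le> x then ftt (t, x) else 0)) = (LBINT t=ereal 0..ereal \<tau>. ftt (t, x))"
      proof (rule interval_integral_restrict)
        fix t :: real assume t: "0 < t" "t < 1" "t \<noteq> \<tau>"
        have "(\<mu> * t \<le> x) = (t < \<tau>)"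
        proof (cases "x < \<mu>")
          case True
          then show ?thesis using t x by (auto simp: \<tau>_def field_simps)
        next
          case False
          have "\<mu> * t \<le> \<mu> * 1" using t mu by (intro mult_left_mono) auto
          then show ?thesis using False t by (auto simp: \<tau>_def)
        qed
        then show "(if \<mu> * t \<le> x then ftt (t, x) else 0) = (if 0 < t \<and> t < \<tau> then ftt (t, x) else 0)"
          using t by simp
      qed (use \<tau> in auto)
      also have "\<dots> = ft (\<tau>, x) - ft (0, x)"
        by (rule interval_integral_FTC_real) (auto intro!: cont_comp cont dtt continuous_intros)
      also have "ft (\<tau>, x) = h x" by (simp add: \<tau>_def h_def end_time)
      finally show "(LBINT t=0..1. (if \<mu> * t \<le> x then ftt (t, x) else 0)) = h x - ft (0, x)" .
    qed
    also have "\<dots> = (LBINT x=0..1. h x) - (LBINT x=0..1. ft (0, x))"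
    proof (rule interval_lebesgue_integral_diff)
      show "interval_lebesgue_integrable lborel 0 1 (\<lambda>x. ft (0, x))"
        by (intro interval_integrable_unit_continuous continuous_intros cont_comp cont)
      \<comment> \<open>Read as multiplication by \<open>inverse \<mu>\<close>, the division is
        continuous for \<mu> = 0 too, because \<open>inverse 0 = 0\<close>.\<close>
      have c: "continuous_on UNIV (\<lambda>x. ft (x / \<mu>, x))"
        unfolding divide_inverse by (intro continuous_intros cont_comp cont)
      then have [measurable]: "(\<lambda>x. ft (x / \<mu>, x)) \<in> borel_measurable borel"
        by (rule borel_measurable_continuous_onI)
      show "interval_lebesgue_integrable lborel 0 1 h"
        using interval_integrable_unit_continuous[OF c]
        unfolding interval_integrable_unit h_def
        by (rule Bochner_Integration.integrable_bound) (auto split: if_splits)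
    qed
    also have "(LBINT x=0..1. h x) = (LBINT x=ereal 0..ereal \<mu>. ft (x / \<mu>, x))"
      by (rule interval_integral_restrict) (use mu in \<open>auto simp: h_def\<close>)
    \<comment> \<open>The substitution \<open>x = \<mu> * s\<close> parametrises the characteristic
      by time; for \<mu> = 0 both sides are 0.\<close>
    also have "\<dots> = \<mu> * (LBINT s=0..1. ft (s, \<mu> * s))"
    proof (cases "\<mu> = 0")
      case False
      have "(LBINT s=ereal 0..ereal 1. \<mu> *\<^sub>R ft ((\<mu> * s) / \<mu>, \<mu> * s)) =
          (LBINT x=ereal (\<mu> * 0)..ereal (\<mu> * 1). ft (x / \<mu>, x))"
        by (rule interval_integral_substitution_finite)
          (use False in \<open>auto intro!: derivative_eq_intros continuous_intros
             intro: continuous_on_subset[OF cont_comp[OF cont(1), of "\<lambda>x. x / \<mu>"]]\<close>)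
      then show ?thesis using False by (simp add: zero_ereal_def one_ereal_def)
    qed simp
    finally show ?thesis .
  qed
  finally have "(LBINT t=0..1. R t) = \<mu> * ((LBINT s=0..1. ft (s, \<mu> * s)) + \<mu> * (LBINT t=0..1. fx (t, \<mu> * t)))
     - (LBINT x=0..1. ft (0, x)) - \<mu>\<^sup>2 * (LBINT t=0..1. fx (t, 1))"
    by (simp add: algebra_simps power2_eq_square)
  also have "(LBINT s=0..1. ft (s, \<mu> * s)) + \<mu> * (LBINT t=0..1. fx (t, \<mu> * t)) =
      (LBINT s=0..1. ft (s, \<mu> * s) + \<mu> * fx (s, \<mu> * s))"
    by (subst interval_lebesgue_integral_add)
      (auto intro!: interval_integrable_unit_continuous continuous_intros cont_comp cont)
  also have "\<dots> = f (1, \<mu> * 1) - f (0, \<mu> * 0)"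
    unfolding zero_ereal_def one_ereal_def
    by (rule interval_integral_FTC_real[where F = "\<lambda>s. f (s, \<mu> * s)"])
      (auto intro!: continuous_intros cont_comp cont dchar)
  finally show "(LBINT t=0..1. R t) =
      - \<mu> * f (0, 0) - (LBINT x=0..1. ft (0, x)) - \<mu>\<^sup>2 * (LBINT t=0..1. fx (t, 1))"
    by (simp add: end_time)
qed

subsection \<open>The d'Alembert formula gives distributional solutions\<close>

text \<open>The averaged step is 1 to the left of \<open>- c\<close>, 0 in between and -1 to the
  right of \<open>c\<close>; the left half is reflected onto (0, 1). Taking
  \<open>c = \<mu> * t\<close> treats the interior term, and \<open>c = 0\<close> the initial
  term.\<close>

lemma u0_split_integral:
  fixes g :: "real \<Rightarrow> real"
  assumes c: "0 \<le> c" and g: "continuous_on UNIV g"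
  shows "(LBINT x=(-1)..1. (u0 (x - c) + u0 (x + c)) / 2 * g x) =
    (LBINT x=0..1. (if c \<le> x then g (- x) else 0)) - (LBINT x=0..1. (if c \<le> x then g x else 0))"
proof -
  let ?w = "\<lambda>x. (u0 (x - c) + u0 (x + c)) / 2 * g x"
  have [measurable]: "g \<in> borel_measurable borel"
    using g by (rule borel_measurable_continuous_onI)
  have "interval_lebesgue_integrable lborel (-1) 1 g"
    using interval_integrable_continuous_on[of "-1" 1 g] g
    by (simp add: one_ereal_def continuous_on_subset)
  then have "interval_lebesgue_integrable lborel (-1) 1 ?w"
  proof -
    have le: "(-1 :: ereal) \<le> 1" by (simp add: one_ereal_def)
    assume "interval_lebesgue_integrable lborel (-1) 1 g"
    then have "integrable lborel (\<lambda>x. indicator (einterval (-1) 1) x *\<^sub>R g x)"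
      using le by (simp add: interval_lebesgue_integrable_def set_integrable_def)
    then have "integrable lborel (\<lambda>x. indicator (einterval (-1) 1) x *\<^sub>R ?w x)"
    proof (rule Bochner_Integration.integrable_bound)
      show "(\<lambda>x. indicator (einterval (-1) 1) x *\<^sub>R ?w x) \<in> borel_measurable lborel"
        by measurable
      show "AE x in lborel. norm (indicator (einterval (-1) 1) x *\<^sub>R ?w x)
          \<le> norm (indicator (einterval (-1) 1) x *\<^sub>R g x)"
        by (rule AE_I2) (simp add: indicator_def u0_def abs_mult)
    qed
    then show ?thesis
      using le by (simp add: interval_lebesgue_integrable_def set_integrable_def)
  qed
  then have "(LBINT x=(-1)..1. ?w x) = (LBINT x=(-1)..0. ?w x) + (LBINT x=0..1. ?w x)"
    by (subst interval_integral_sum) (simp_all add: min_def max_def one_ereal_def zero_ereal_def)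
  also have "(LBINT x=(-1)..0. ?w x) = (LBINT x=0..1. ?w (- x))"
    by (subst interval_integral_reflect) simp
  also have "\<dots> = (LBINT x=0..1. (if c \<le> x then g (- x) else 0))"
    unfolding interval_integral_unit
    \<comment> \<open>For \<open>c > 0\<close> the step at \<open>- c\<close> is already 0, so after
      reflection the two integrands may differ at the single point \<open>c\<close>.\<close>
    by (rule integral_discrete_difference[where X = "{c}"])
      (use c in \<open>auto simp: u0_def indicator_def\<close>)
  also have "(LBINT x=0..1. ?w x) = (LBINT x=0..1. - (if c \<le> x then g x else 0))"
    unfolding interval_integral_unit
    by (rule Bochner_Integration.integral_cong)
      (use c in \<open>auto simp: u0_def indicator_def\<close>)
  finally show ?thesis by (simp add: interval_lebesgue_integral_uminus)
qed

lemma has_real_derivative_along_curve: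
  fixes f :: "real \<times> real \<Rightarrow> real"
  assumes f: "(f has_derivative D) (at (p s, q s))"
    and p: "(p has_real_derivative p') (at s)" and q: "(q has_real_derivative q') (at s)"
  shows "((\<lambda>s. f (p s, q s)) has_real_derivative D (p', q')) (at s)"
proof -
  interpret D: bounded_linear D using f by (rule has_derivative_bounded_linear)
  have "((\<lambda>s. (p s, q s)) has_derivative (\<lambda>h. (p' * h, q' * h))) (at s)"
    using p q by (auto intro!: has_derivative_Pair simp: has_field_derivative_def)
  from has_derivative_compose[OF this f]
  have "((\<lambda>s. f (p s, q s)) has_derivative (\<lambda>h. D (p' * h, q' * h))) (at s)" .
  moreover have "D (p' * h, q' * h) = D (p', q') * h" for h
    using D.scaleR[of h "(p', q')"] by (simp add: mult.commute)
  ultimately show ?thesis by (simp add: has_field_derivative_def)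
qed

text \<open>All three are chain rules for the total derivative \<open>D\<close> along a line, with
  \<open>D (1, c) = D (1, 0) + c * D (0, 1)\<close> for the slanted one. The third is the derivative
  along a characteristic, for c = \<mu> and, in the reflected half, c = -\<mu>.\<close>

lemma partial_derivatives:
  assumes "f differentiable at (t, x)"
  shows "((\<lambda>s. f (s, x)) has_real_derivative partial_t f (t, x)) (at t)"
    and "((\<lambda>y. f (t, y)) has_real_derivative partial_x f (t, x)) (at x)"
    and "t = s \<Longrightarrow> x = c * s \<Longrightarrow>
      ((\<lambda>s. f (s, c * s)) has_real_derivative partial_t f (t, x) + c * partial_x f (t, x)) (at s)"
proof -
  obtain D where D: "(f has_derivative D) (at (t, x))"
    using assms by (auto simp: differentiable_def)
  interpret D: bounded_linear D using D by (rule has_derivative_bounded_linear)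
  have dt: "((\<lambda>s. f (s, x)) has_real_derivative D (1, 0)) (at t)"
    using has_real_derivative_along_curve[where p = "\<lambda>s. s" and q = "\<lambda>s. x", OF D]
    by (simp add: DERIV_ident)
  have dx: "((\<lambda>y. f (t, y)) has_real_derivative D (0, 1)) (at x)"
    using has_real_derivative_along_curve[where p = "\<lambda>s. t" and q = "\<lambda>y. y", OF D]
    by (simp add: DERIV_ident)
  have eq: "partial_t f (t, x) = D (1, 0)" "partial_x f (t, x) = D (0, 1)"
    using dt dx by (auto simp: partial_t_def partial_x_def DERIV_imp_deriv)
  show "((\<lambda>s. f (s, x)) has_real_derivative partial_t f (t, x)) (at t)"
    and "((\<lambda>y. f (t, y)) has_real_derivative partial_x f (t, x)) (at x)"
    using dt dx by (simp_all add: eq)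
  assume ts: "t = s" "x = c * s"
  have "((\<lambda>s. f (s, c * s)) has_real_derivative D (1, c)) (at s)"
    using has_real_derivative_along_curve[where p = "\<lambda>s. s" and q = "\<lambda>s. c * s", OF D[unfolded ts]
        DERIV_ident DERIV_cmult_Id] by simp
  moreover have "D (1, c) = D (1, 0) + c * D (0, 1)"
    using D.add[of "(1, 0)" "c *\<^sub>R (0, 1)"] D.scaleR[of c "(0, 1)"] by simp
  ultimately show "((\<lambda>s. f (s, c * s)) has_real_derivative partial_t f (t, x) + c * partial_x f (t, x)) (at s)"
    by (simp add: eq)
qed

lemma smooth_imp:
  assumes "smooth f"
  shows smooth_partial_t: "smooth (partial_t f)" and smooth_partial_x: "smooth (partial_x f)"
    and smooth_differentiable: "f differentiable (at p)" and smooth_continuous: "continuous_on UNIV f"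
proof -
  have "C_k 0 f" and step: "C_k (Suc k) f" for k
    using assms by (simp_all only: smooth_def)
  then show "continuous_on UNIV f" by simp
  show "smooth (partial_t f)" "smooth (partial_x f)"
    unfolding smooth_def using step by simp_all
  show "f differentiable (at p)"
    using step[of 0] unfolding C_k.simps(2) by blast
qed

text \<open>A point outside the closed support has a neighbourhood on which \<phi> vanishes, hence
  the time derivative vanishes there too. This supplies the end conditions at
  \<open>t = 1\<close>.\<close>

lemma Cc_infinity_vanishes:
  assumes "\<phi> \<in> Cc_infinity U" "(t, x) \<notin> U"
  shows "\<phi> (t, x) = 0" "partial_t \<phi> (t, x) = 0"
proof -
  let ?S = "closure {p. \<phi> p \<noteq> 0}"
  have outside: "\<phi> p = 0" if "p \<notin> ?S" for p
    using closure_subset[of "{p. \<phi> p \<noteq> 0}"] that by auto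
  have nin: "(t, x) \<notin> ?S" using assms by (auto simp: Cc_infinity_def)
  then show "\<phi> (t, x) = 0" by (rule outside)
  have "open ((\<lambda>s. (s, x)) -` (- ?S))"
    by (rule open_vimage[OF open_Compl[OF closed_closure]], intro continuous_on_Pair) simp_all
  then have "\<forall>\<^sub>F s in nhds t. s \<in> (\<lambda>s. (s, x)) -` (- ?S)"
    by (rule eventually_nhds_in_open) (simp add: nin)
  then have "\<forall>\<^sub>F s in nhds t. \<phi> (s, x) = 0"
    by eventually_elim (rule outside, simp)
  then have "deriv (\<lambda>s. \<phi> (s, x)) t = deriv (\<lambda>s. 0) t"
    by (rule deriv_cong_ev) (rule refl)
  then show "partial_t \<phi> (t, x) = 0" by (simp add: partial_t_def)
qed

text \<open>The strip is cut at \<open>x = 0\<close> and \<open>half_wave_identity\<close> is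
  applied to each half, the left one reflected. In the difference of the two identities the terms
  with \<open>\<phi> (0, 0)\<close> cancel, and what remains is the negative of the initial and
  boundary terms.\<close>

lemma distributional_solution_wave:
  assumes mu: "0 \<le> \<mu>" "\<mu> \<le> 1"
  shows "distributional_solution \<mu> (wave \<mu>)"
  unfolding distributional_solution_def
proof (intro conjI ballI impI)
  show "square_integrable (wave \<mu>)" by (rule square_integrable_wave)
  fix \<phi> assume phi: "\<phi> \<in> Cc_infinity ({..<1} \<times> UNIV)"
  define ft where "ft = partial_t \<phi>"
  define fx where "fx = partial_x \<phi>"
  define ftt where "ftt = partial_t ft"
  define fxx where "fxx = partial_x fx"
  have "smooth \<phi>" using phi unfolding Cc_infinity_def by blast
  then have smooth: "smooth \<phi>" "smooth ft" "smooth fx" "smooth ftt" "smooth fxx"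
    unfolding ft_def fx_def ftt_def fxx_def
    using \<open>smooth \<phi>\<close> by (simp_all only: smooth_partial_t smooth_partial_x)
  note cont = smooth[THEN smooth_continuous]
  note diff = smooth[THEN smooth_differentiable]
  have cont_neg: "continuous_on UNIV (\<lambda>p :: real \<times> real. h (fst p, - snd p))"
    if "continuous_on UNIV h" for h :: "real \<times> real \<Rightarrow> real"
    by (rule continuous_on_compose2[OF that], intro continuous_intros) simp
  have cont_x: "continuous_on UNIV (\<lambda>x. h (t, x))" and cont_t: "continuous_on UNIV (\<lambda>t. h (t, x))"
    if "continuous_on UNIV h" for h :: "real \<times> real \<Rightarrow> real" and t x
    by (rule continuous_on_compose2[OF that]; simp add: continuous_on_Pair)+
  \<comment> \<open>\<open>P\<close> and \<open>Q\<close> integrate over the right and the left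
    wedge, where \<open>wave \<mu>\<close> is -1 and 1; between the characteristics it is 0.\<close>
  define P where "P t = (LBINT x=0..1. (if \<mu> * t \<le> x then ftt (t, x) - \<mu>\<^sup>2 * fxx (t, x) else 0))" for t
  define Q where "Q t = (LBINT x=0..1. (if \<mu> * t \<le> x then ftt (t, - x) - \<mu>\<^sup>2 * fxx (t, - x) else 0))" for t
  have P: "interval_lebesgue_integrable lborel 0 1 P"
    "(LBINT t=0..1. P t) = - \<mu> * \<phi> (0, 0) - (LBINT x=0..1. ft (0, x)) - \<mu>\<^sup>2 * (LBINT t=0..1. fx (t, 1))"
  proof -
    have dtt: "((\<lambda>s. ft (s, x)) has_real_derivative ftt (t, x)) (at t)" for t x
      unfolding ftt_def by (rule partial_derivatives(1)[OF diff(2)])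
    have dxx: "((\<lambda>y. fx (t, y)) has_real_derivative fxx (t, x)) (at x)" for t x
      unfolding fxx_def by (rule partial_derivatives(2)[OF diff(3)])
    have dchar: "((\<lambda>s. \<phi> (s, \<mu> * s)) has_real_derivative ft (s, \<mu> * s) + \<mu> * fx (s, \<mu> * s)) (at s)" for s
      unfolding ft_def fx_def by (rule partial_derivatives(3)[OF diff(1) refl refl])
    note * = half_wave_identity[where f = \<phi>, OF mu cont(2-5) dtt dxx dchar]
    show "interval_lebesgue_integrable lborel 0 1 P"
      "(LBINT t=0..1. P t) = - \<mu> * \<phi> (0, 0) - (LBINT x=0..1. ft (0, x)) - \<mu>\<^sup>2 * (LBINT t=0..1. fx (t, 1))"
      unfolding P_def by (rule *; simp add: Cc_infinity_vanishes[OF phi] ft_def)+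
  qed
  have Q: "interval_lebesgue_integrable lborel 0 1 Q"
    "(LBINT t=0..1. Q t) = - \<mu> * \<phi> (0, 0) - (LBINT x=0..1. ft (0, - x)) + \<mu>\<^sup>2 * (LBINT t=0..1. fx (t, - 1))"
  proof -
    have dtt: "((\<lambda>s. ft (s, - x)) has_real_derivative ftt (t, - x)) (at t)" for t x
      unfolding ftt_def by (rule partial_derivatives(1)[OF diff(2)])
    have dxx: "((\<lambda>y. - fx (t, - y)) has_real_derivative fxx (t, - x)) (at x)" for t x
      using DERIV_minus[OF DERIV_chain2[OF partial_derivatives(2)[OF diff(3), of t "- x"] DERIV_minus[OF DERIV_ident]]]
      by (simp add: fxx_def)
    have dchar: "((\<lambda>s. \<phi> (s, - (\<mu> * s))) has_real_derivative
        ft (s, - (\<mu> * s)) + \<mu> * - fx (s, - (\<mu> * s))) (at s)" for s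
      using partial_derivatives(3)[OF diff(1) refl refl, where c = "- \<mu>" and s = s]
      by (simp add: ft_def fx_def)
    \<comment> \<open>Under x \<mapsto> -x the first space derivative changes sign and the second
      does not, so the reflected test function fits the same identity.\<close>
    note * = half_wave_identity[where f = "\<lambda>p. \<phi> (fst p, - snd p)" and ft = "\<lambda>p. ft (fst p, - snd p)"
        and fx = "\<lambda>p. - fx (fst p, - snd p)" and ftt = "\<lambda>p. ftt (fst p, - snd p)"
        and fxx = "\<lambda>p. fxx (fst p, - snd p)", OF mu cont_neg[OF cont(2)]
        continuous_on_minus[OF cont_neg[OF cont(3)]] cont_neg[OF cont(4)] cont_neg[OF cont(5)],
        unfolded fst_conv snd_conv, OF dtt dxx dchar]
    have "interval_lebesgue_integrable lborel 0 1 Q \<and>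
      (LBINT t=0..1. Q t) = - \<mu> * \<phi> (0, - 0) - (LBINT x=0..1. ft (0, - x))
        - \<mu>\<^sup>2 * (LBINT t=0..1. - fx (t, - 1))"
      unfolding Q_def by (intro conjI *) (simp_all add: Cc_infinity_vanishes[OF phi] ft_def)
    then show "interval_lebesgue_integrable lborel 0 1 Q"
      "(LBINT t=0..1. Q t) = - \<mu> * \<phi> (0, 0) - (LBINT x=0..1. ft (0, - x)) + \<mu>\<^sup>2 * (LBINT t=0..1. fx (t, - 1))"
      by (simp_all add: interval_lebesgue_integral_uminus)
  qed
  have "(LBINT t=0..1. (LBINT x=(-1)..1. wave \<mu> (t, x) * (ftt (t, x) - \<mu>\<^sup>2 * fxx (t, x)))) =
      (LBINT t=0..1. Q t - P t)"
  proof (rule interval_integral_cong)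
    fix t :: real assume "t \<in> einterval (min 0 1) (max 0 1)"
    then have "0 \<le> \<mu> * t" using mu by (auto simp: einterval_iff zero_ereal_def one_ereal_def)
    then show "(LBINT x=(-1)..1. wave \<mu> (t, x) * (ftt (t, x) - \<mu>\<^sup>2 * fxx (t, x))) = Q t - P t"
      unfolding wave_def P_def Q_def prod.case
      by (rule u0_split_integral) (intro continuous_intros cont_x[OF cont(4)] cont_x[OF cont(5)])
  qed
  also have "\<dots> = (LBINT t=0..1. Q t) - (LBINT t=0..1. P t)"
    using P Q by simp
  also have "\<dots> = (LBINT x=0..1. ft (0, x)) - (LBINT x=0..1. ft (0, - x))
      + \<mu>\<^sup>2 * ((LBINT t=0..1. fx (t, 1)) + (LBINT t=0..1. fx (t, - 1)))"
    by (simp add: P Q algebra_simps)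
  finally have 1: "(LBINT t=0..1. (LBINT x=(-1)..1. wave \<mu> (t, x) * (ftt (t, x) - \<mu>\<^sup>2 * fxx (t, x)))) = \<dots>" .
  have "(LBINT x=(-1)..1. (u0 (x - 0) + u0 (x + 0)) / 2 * ft (0, x)) =
      (LBINT x=0..1. (if 0 \<le> x then ft (0, - x) else 0)) - (LBINT x=0..1. (if 0 \<le> x then ft (0, x) else 0))"
    by (rule u0_split_integral[OF order_refl cont_x[OF cont(2)]])
  also have "(LBINT x=0..1. (if 0 \<le> x then ft (0, x) else 0)) = (LBINT x=0..1. ft (0, x))"
    by (rule interval_integral_cong) (auto simp: einterval_iff zero_ereal_def one_ereal_def)
  also have "(LBINT x=0..1. (if 0 \<le> x then ft (0, - x) else 0)) = (LBINT x=0..1. ft (0, - x))"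
    by (rule interval_integral_cong) (auto simp: einterval_iff zero_ereal_def one_ereal_def)
  finally have 2: "(LBINT x=(-1)..1. u0 x * ft (0, x)) = (LBINT x=0..1. ft (0, - x)) - (LBINT x=0..1. ft (0, x))"
    by simp
  have 3: "(LBINT t=0..1. fx (t, 1) + fx (t, - 1)) = (LBINT t=0..1. fx (t, 1)) + (LBINT t=0..1. fx (t, - 1))"
    by (intro interval_lebesgue_integral_add interval_integrable_unit_continuous cont_t[OF cont(3)])
  show "(LBINT t=0..1. (LBINT x=(-1)..1.
            wave \<mu> (t, x) * (partial_t (partial_t \<phi>) (t, x) - \<mu>\<^sup>2 * partial_x (partial_x \<phi>) (t, x))))
        + (LBINT x=(-1)..1. u0 x * partial_t \<phi> (0, x))
        - \<mu>\<^sup>2 * (LBINT t=0..1. partial_x \<phi> (t, 1) + partial_x \<phi> (t, -1)) = 0"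
    using 1 2 3 by (simp add: ft_def fx_def ftt_def fxx_def)
qed

subsection \<open>The lower bound\<close>

theorem theorem4p5:
  fixes N :: nat
  assumes "N \<ge> 1"
  shows "kolmogorov_width N solution_manifold \<ge> ennreal (1 / 4 * real N powr (- 1 / 2))"
  unfolding kolmogorov_width_def
proof (rule INF_greatest)
  fix V :: "L2 set"
  assume "V \<in> {V. subspace V \<and> (\<exists>B. finite B \<and> span B = V) \<and> dim V = N}"
  then obtain B where V: "subspace V" "finite B" "span B = V" "dim V = N" by auto
  let ?c = "1 / 4 * real N powr (- 1 / 2)"
  \<comment> \<open>With twice as many differences as dimensions, \<open>1 - N / M\<close> is 1/2;
    together with the squared norm \<open>1 / M\<close> this gives the squared distance
    \<open>1 / (4 * N)\<close>.\<close>
  define M where "M = 2 * N"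
  define \<mu> where "\<mu> k = real k / real M" for k
  define e where "e k = to_L2 (wave (\<mu> k)) - to_L2 (wave (\<mu> (Suc k)))" for k
  have M: "M > 0" using assms by (simp add: M_def)
  have mono: "\<mu> j \<le> \<mu> k" if "j \<le> k" for j k
    using that by (simp add: \<mu>_def divide_right_mono)
  have bounds: "0 \<le> \<mu> k" "k \<le> M \<Longrightarrow> \<mu> k \<le> 1" for k
    using M by (auto simp: \<mu>_def divide_le_eq)
  \<comment> \<open>The index \<open>M\<close> is included: \<open>M\<close> differences involve
    \<open>M + 1\<close> solutions, the last with parameter 1.\<close>
  have in_manifold: "to_L2 (wave (\<mu> k)) \<in> solution_manifold" if "k \<le> M" for k
    unfolding solution_manifold_def
    using bounds(1)[of k] bounds(2)[OF that] distributional_solution_wave[of "\<mu> k"]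
    by (intro CollectI exI[of _ "wave (\<mu> k)"] exI[of _ "\<mu> k"]) simp
  have orth_less: "inner (e j) (e k) = 0" if "j < k" for j k
    unfolding e_def using that by (intro inner_wave_diff_disjoint bounds mono) auto
  have orth: "inner (e j) (e k) = 0" if "j \<noteq> k" for j k
    using orth_less[of j k] orth_less[of k j] that by (cases j k rule: linorder_cases) (auto simp: inner_commute)
  have sq: "(norm (e k))\<^sup>2 = 1 / real M" if "k < M" for k
  proof -
    have "(norm (e k))\<^sup>2 = \<mu> (Suc k) - \<mu> k"
      unfolding e_def using that by (intro norm_wave_diff bounds mono) auto
    then show ?thesis by (simp add: \<mu>_def diff_divide_distrib[symmetric])
  qed
  have norm: "norm (e k) = sqrt (1 / real M)" if "k \<in> {..<M}" for k
    using real_sqrt_unique[OF sq[of k]] that by simp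
  obtain k where k: "k \<in> {..<M}"
    and far: "\<And>v. v \<in> V \<Longrightarrow>
      (sqrt (1 / real M))\<^sup>2 * (1 - real (dim V) / real (card {..<M})) \<le> (norm (e k - v))\<^sup>2"
    by (rule orthogonal_family_far_from_subspace[of "{..<M}" e, OF _ _ norm orth V(1-3)])
      (use M in auto)
  \<comment> \<open>The distance of a difference from \<open>V\<close> is twice the claimed bound;
    the factor 2 is spent in the triangle inequality below.\<close>
  have "(2 * ?c)\<^sup>2 = 1 / (4 * real N)"
    using assms by (simp add: power_mult_distrib powr_minus_divide powr_half_sqrt power_divide)
  also have "\<dots> = (sqrt (1 / real M))\<^sup>2 * (1 - real (dim V) / real (card {..<M}))"
  proof -
    have "(sqrt (1 / real M))\<^sup>2 = 1 / (2 * real N)" by (simp add: M_def)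
    moreover have "real (dim V) / real (card {..<M}) = 1 / 2"
      unfolding V(4) using assms by (simp add: M_def)
    ultimately show ?thesis by simp
  qed
  finally have eq: "(2 * ?c)\<^sup>2 = (sqrt (1 / real M))\<^sup>2 * (1 - real (dim V) / real (card {..<M}))" .
  have far': "2 * ?c \<le> norm (e k - v)" if "v \<in> V" for v
    by (rule power2_le_imp_le[OF _ norm_ge_zero]) (simp only: eq far[OF that])
  show "ennreal ?c \<le> (SUP u\<in>solution_manifold. INF v\<in>V. ennreal (norm (u - v)))"
  proof (rule ccontr)
    assume "\<not> ?thesis"
    then have less: "(INF v\<in>V. ennreal (norm (u - v))) < ennreal ?c" if "u \<in> solution_manifold" for u
      using that by (auto intro: le_less_trans[OF SUP_upper[OF that]])
    have "\<exists>v\<in>V. norm (to_L2 (wave (\<mu> j)) - v) < ?c" if "j \<le> M" for j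
      using less[OF in_manifold[OF that]] by (auto simp: INF_less_iff ennreal_less_iff)
    from this[of k] this[of "Suc k"] obtain v w where vw: "v \<in> V" "w \<in> V" "norm (to_L2 (wave (\<mu> k)) - v) < ?c"
      "norm (to_L2 (wave (\<mu> (Suc k))) - w) < ?c"
      using k by (auto simp: Suc_le_eq dest: less_imp_le)
    \<comment> \<open>If both solutions had approximants \<open>v\<close> and \<open>w\<close> in
      \<open>V\<close> closer than \<open>?c\<close>, then \<open>v - w\<close> would approximate
      \<open>e k\<close> better than \<open>far'\<close> allows.\<close>
    have "norm (e k - (v - w)) =
        norm ((to_L2 (wave (\<mu> k)) - v) - (to_L2 (wave (\<mu> (Suc k))) - w))"
      by (simp add: e_def algebra_simps)
    also have "\<dots> < 2 * ?c"
      using norm_triangle_ineq4[of "to_L2 (wave (\<mu> k)) - v" "to_L2 (wave (\<mu> (Suc k))) - w"] vw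
      by linarith
    finally show False
      using far'[OF subspace_diff[OF V(1) vw(1,2)]] by simp
  qed
qed

end
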